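(* The error $e_k=\hat{s}_k-s_k$ and the computed correction $\hat{c}_k$ in compensated summation of real numbers $x_1,\ldots,x_n$ satisfy $$\begin{bmatrix}e_k\\ \hat{c}_k\end{bmatrix}=\sum_{j=2}^{k-1}(P_k\cdots P_{j+1})\,\widetilde{P}_j\begin{bmatrix}s_j\\ x_j\end{bmatrix}+\widetilde{P}_k\begin{bmatrix}s_k\\ x_k\end{bmatrix},\qquad 2\le k\le n,$$ where $$P_k\equiv\begin{bmatrix}1+\sigma_k&-(1+\eta_k)(1+\sigma_k)\\ \sigma_k\Psi_k&(1+\eta_k)(1-\Gamma_k)(1+\beta_k)\end{bmatrix},\qquad \Gamma_k\equiv(1+\sigma_k)(1+\delta_k),\quad\Psi_k\equiv(1+\delta_k)(1+\beta_k),$$ and $$\widetilde{P}_j\equiv\begin{bmatrix}\sigma_j&\eta_j(1+\sigma_j)\\ \sigma_j\Psi_j&(1+\beta_j)\bigl(\delta_j+\eta_j(\Gamma_j-1)\bigr)\end{bmatrix}=\mathcal{O}(u),\qquad 2\le j\le n.$$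
   Context: Let $x_1,\ldots,x_n$ be real numbers ($n\ge 2$), $s_k=\sum_{j=1}^k x_j$ the exact partial sums, and $0<u<1$ the unit roundoff. The finite precision model of compensated (Kahan) summation is $$\hat{s}_1=s_1=x_1,\qquad\hat{c}_1=0,$$ and for $2\le k\le n$ $$\hat{y}_k=(x_k-\hat{c}_{k-1})(1+\eta_k),\quad \hat{s}_k=(\hat{s}_{k-1}+\hat{y}_k)(1+\sigma_k),\quad \hat{c}_k=\bigl((\hat{s}_k-\hat{s}_{k-1})(1+\delta_k)-\hat{y}_k\bigr)(1+\beta_k),$$ with $\eta_2=0$ and $|\eta_k|,|\sigma_k|,|\delta_k|,|\beta_k|\le u$. $\mathcal{O}(u)$ is as $u\to0$, uniformly over all roundoffs bounded by $u$. Empty sums equal $0$. *)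

theory Defs
  imports "HOL-Analysis.Analysis"
begin

text \<open>
  All sequences are indexed as in the mathematical text: \<open>x\<close> by \<open>1..n\<close>, the roundoffs by \<open>2..n\<close>.
  Values outside these ranges are irrelevant.
\<close>

definition partial_sum :: "(nat \<Rightarrow> real) \<Rightarrow> nat \<Rightarrow> real" where
  "partial_sum x k = (\<Sum>j=1..k. x j)"

definition roundoffs ::
  "nat \<Rightarrow> real \<Rightarrow> (nat \<Rightarrow> real) \<Rightarrow> (nat \<Rightarrow> real) \<Rightarrow> (nat \<Rightarrow> real) \<Rightarrow> (nat \<Rightarrow> real) \<Rightarrow> bool" where
  "roundoffs n u \<eta> \<sigma> \<delta> \<beta> \<longleftrightarrow>
     \<eta> 2 = 0 \<and>
     (\<forall>k\<in>{2..n}. \<bar>\<eta> k\<bar> \<le> u \<and> \<bar>\<sigma> k\<bar> \<le> u \<and> \<bar>\<delta> k\<bar> \<le> u \<and> \<bar>\<beta> k\<bar> \<le> u)"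

definition compensated_summation ::
  "nat \<Rightarrow> (nat \<Rightarrow> real) \<Rightarrow> (nat \<Rightarrow> real) \<Rightarrow> (nat \<Rightarrow> real) \<Rightarrow> (nat \<Rightarrow> real) \<Rightarrow> (nat \<Rightarrow> real) \<Rightarrow>
   (nat \<Rightarrow> real) \<Rightarrow> (nat \<Rightarrow> real) \<Rightarrow> (nat \<Rightarrow> real) \<Rightarrow> bool" where
  "compensated_summation n x \<eta> \<sigma> \<delta> \<beta> yh sh ch \<longleftrightarrow>
     sh 1 = x 1 \<and> ch 1 = 0 \<and>
     (\<forall>k\<in>{2..n}.
        yh k = (x k - ch (k - 1)) * (1 + \<eta> k) \<and>
        sh k = (sh (k - 1) + yh k) * (1 + \<sigma> k) \<and>
        ch k = ((sh k - sh (k - 1)) * (1 + \<delta> k) - yh k) * (1 + \<beta> k))"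

definition Gamma_fac :: "(nat \<Rightarrow> real) \<Rightarrow> (nat \<Rightarrow> real) \<Rightarrow> nat \<Rightarrow> real" where
  "Gamma_fac \<sigma> \<delta> k = (1 + \<sigma> k) * (1 + \<delta> k)"

definition Psi_fac :: "(nat \<Rightarrow> real) \<Rightarrow> (nat \<Rightarrow> real) \<Rightarrow> nat \<Rightarrow> real" where
  "Psi_fac \<delta> \<beta> k = (1 + \<delta> k) * (1 + \<beta> k)"

definition P_mat ::
  "(nat \<Rightarrow> real) \<Rightarrow> (nat \<Rightarrow> real) \<Rightarrow> (nat \<Rightarrow> real) \<Rightarrow> (nat \<Rightarrow> real) \<Rightarrow> nat \<Rightarrow> real^2^2" where
  "P_mat \<eta> \<sigma> \<delta> \<beta> k = vector
     [vector [1 + \<sigma> k, - (1 + \<eta> k) * (1 + \<sigma> k)],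
      vector [\<sigma> k * Psi_fac \<delta> \<beta> k, (1 + \<eta> k) * (1 - Gamma_fac \<sigma> \<delta> k) * (1 + \<beta> k)]]"

definition P_tilde ::
  "(nat \<Rightarrow> real) \<Rightarrow> (nat \<Rightarrow> real) \<Rightarrow> (nat \<Rightarrow> real) \<Rightarrow> (nat \<Rightarrow> real) \<Rightarrow> nat \<Rightarrow> real^2^2" where
  "P_tilde \<eta> \<sigma> \<delta> \<beta> j = vector
     [vector [\<sigma> j, \<eta> j * (1 + \<sigma> j)],
      vector [\<sigma> j * Psi_fac \<delta> \<beta> j, (1 + \<beta> j) * (\<delta> j + \<eta> j * (Gamma_fac \<sigma> \<delta> j - 1))]]"

text \<open>\<open>desc_prod M j k\<close> is \<open>M k ** \<dots> ** M (j + 1)\<close>, with the largest index leftmost.\<close>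

definition desc_prod :: "(nat \<Rightarrow> real^2^2) \<Rightarrow> nat \<Rightarrow> nat \<Rightarrow> real^2^2" where
  "desc_prod M j k = foldr (\<lambda>i A. M i ** A) (rev [j + 1..<k + 1]) (mat 1)"

end

theory Submission
  imports Defs
begin

text \<open>
  Eliminating \<open>yh\<close> and writing \<open>sh = s + e\<close> turns one pass of the compensated loop into an
  affine map of the error vector \<open>(e, ch)\<close>, with linear part \<open>P\<close>. The exact sums enter this map both
  as \<open>s (k - 1)\<close> and as \<open>s k\<close>; replacing \<open>s (k - 1)\<close> by \<open>s k - x k\<close> collects the inhomogeneous term
  as \<open>P_tilde k\<close> applied to \<open>(s k, x k)\<close>, and everything in it that is not proportional to a
  roundoff cancels (\<open>error_recurrence\<close>). The loop starts from the zero error vector, so unrolling the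
  recurrence (\<open>affine_recurrence_unroll\<close>) gives the stated sum.

  The \<open>O(u)\<close> bound is read off the entries: each is a roundoff, or a sum of two terms each
  containing one, times factors that stay bounded as long as \<open>u \<le> 1\<close>. The constant \<open>8\<close>, forced
  on this estimate by the lower right entry with \<open>\<bar>\<Gamma> - 1\<bar> \<le> 3\<close> and \<open>\<bar>1 + \<beta>\<bar> \<le> 2\<close>, then works for
  every \<open>n\<close> and every choice of roundoffs.
\<close>

lemma desc_prod_refl: "desc_prod M k k = mat 1"
  by (simp add: desc_prod_def)

lemma desc_prod_Suc: "j \<le> k \<Longrightarrow> desc_prod M j (Suc k) = M (Suc k) ** desc_prod M j k"
  by (simp add: desc_prod_def)

text \<open>
  Discrete variation of constants. The term \<open>w m\<close> is kept inside the sum, with the empty product as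
  its coefficient, so that the induction can start at \<open>m = 1\<close> with an empty sum.
\<close>

lemma affine_recurrence_unroll:
  fixes v w :: "nat \<Rightarrow> real^2"
  assumes init: "v 1 = 0"
    and step: "\<And>k. k \<in> {2..n} \<Longrightarrow> v k = M k *v v (k - 1) + w k"
    and "1 \<le> m" "m \<le> n"
  shows "v m = (\<Sum>j=2..m. desc_prod M j m *v w j)"
  using assms(3,4)
proof (induction m rule: dec_induct)
  case base
  show ?case using init by simp
next
  case (step k)
  have "v (Suc k) = M (Suc k) *v v k + w (Suc k)"
    using step.hyps step.prems assms(2)[of "Suc k"] by simp
  also have "v k = (\<Sum>j=2..k. desc_prod M j k *v w j)"
    using step by simp
  also have "M (Suc k) *v (\<Sum>j=2..k. desc_prod M j k *v w j)
      = (\<Sum>j=2..k. desc_prod M j (Suc k) *v w j)"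
    by (simp add: linear_sum[OF matrix_vector_mul_linear] desc_prod_Suc matrix_vector_mul_assoc)
  finally show ?case
    using step.hyps by (simp add: desc_prod_refl)
qed

text \<open>
  In the second component, up to the factor \<open>1 + \<beta>\<close>, the coefficient of \<open>x k\<close> comes out as
  \<open>(\<Gamma> - 1) * (1 + \<eta>) - \<sigma> * (1 + \<delta>)\<close>, the last term stemming from \<open>s (k - 1) = s k - x k\<close>; it reduces
  to \<open>\<delta> + \<eta> * (\<Gamma> - 1)\<close> because \<open>\<Gamma> = (1 + \<sigma>) * (1 + \<delta>)\<close>.
\<close>

lemma error_recurrence:
  assumes "compensated_summation n x \<eta> \<sigma> \<delta> \<beta> yh sh ch" and "k \<in> {2..n}"
  shows "(vector [sh k - partial_sum x k, ch k] :: real^2) =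
           P_mat \<eta> \<sigma> \<delta> \<beta> k *v vector [sh (k - 1) - partial_sum x (k - 1), ch (k - 1)]
           + P_tilde \<eta> \<sigma> \<delta> \<beta> k *v vector [partial_sum x k, x k]"
proof -
  have y: "yh k = (x k - ch (k - 1)) * (1 + \<eta> k)"
    and s: "sh k = (sh (k - 1) + yh k) * (1 + \<sigma> k)"
    and c: "ch k = ((sh k - sh (k - 1)) * (1 + \<delta> k) - yh k) * (1 + \<beta> k)"
    using assms unfolding compensated_summation_def by blast+
  have p: "partial_sum x k = partial_sum x (k - 1) + x k"
    using assms(2) by (cases k) (simp_all add: partial_sum_def)
  show ?thesis
    unfolding vec_eq_iff forall_2
    by (simp add: P_mat_def P_tilde_def matrix_vector_mult_def sum_2 Gamma_fac_def Psi_fac_def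
        p c s y) (simp add: algebra_simps)
qed

lemma abs_mult_le:
  fixes a b :: real
  assumes "\<bar>a\<bar> \<le> p" "\<bar>b\<bar> \<le> q"
  shows "\<bar>a * b\<bar> \<le> p * q"
  using assms unfolding abs_mult by (intro mult_mono) auto

lemma P_tilde_entry_bound:
  assumes r: "roundoffs n u \<eta> \<sigma> \<delta> \<beta>" and j: "j \<in> {2..n}" and "u \<le> 1"
  shows "\<bar>P_tilde \<eta> \<sigma> \<delta> \<beta> j $ a $ b\<bar> \<le> 8 * u"
proof -
  have e: "\<bar>\<eta> j\<bar> \<le> u" "\<bar>\<sigma> j\<bar> \<le> u" "\<bar>\<delta> j\<bar> \<le> u" "\<bar>\<beta> j\<bar> \<le> u"
    using r j unfolding roundoffs_def by blast+
  then have f: "\<bar>1 + \<sigma> j\<bar> \<le> 2" "\<bar>1 + \<delta> j\<bar> \<le> 2" "\<bar>1 + \<beta> j\<bar> \<le> 2" and u: "0 \<le> u"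
    using \<open>u \<le> 1\<close> by linarith+
  have e12: "\<bar>\<eta> j * (1 + \<sigma> j)\<bar> \<le> u * 2"
    using e f by (intro abs_mult_le)
  have e21: "\<bar>\<sigma> j * Psi_fac \<delta> \<beta> j\<bar> \<le> u * (2 * 2)"
    unfolding Psi_fac_def using e f by (intro abs_mult_le)
  have "\<bar>\<sigma> j * (1 + \<delta> j)\<bar> \<le> 1 * 2"
    using e f \<open>u \<le> 1\<close> by (intro abs_mult_le) auto
  then have "\<bar>Gamma_fac \<sigma> \<delta> j - 1\<bar> \<le> 3"
    using e(3) \<open>u \<le> 1\<close> unfolding Gamma_fac_def by (simp add: algebra_simps)
  then have "\<bar>\<eta> j * (Gamma_fac \<sigma> \<delta> j - 1)\<bar> \<le> u * 3"
    using e by (intro abs_mult_le)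
  then have "\<bar>\<delta> j + \<eta> j * (Gamma_fac \<sigma> \<delta> j - 1)\<bar> \<le> 4 * u"
    using e(3) by linarith
  then have e22: "\<bar>(1 + \<beta> j) * (\<delta> j + \<eta> j * (Gamma_fac \<sigma> \<delta> j - 1))\<bar> \<le> 2 * (4 * u)"
    using f by (intro abs_mult_le)
  have "\<forall>a b. \<bar>P_tilde \<eta> \<sigma> \<delta> \<beta> j $ a $ b\<bar> \<le> 8 * u"
    unfolding forall_2 using e(2) e12 e21 e22 u by (simp add: P_tilde_def)
  then show ?thesis by blast
qed

theorem theorem4p2:
  "(\<forall>(n::nat) (u::real) (x::nat \<Rightarrow> real) \<eta> \<sigma> \<delta> \<beta> yh sh ch.
      n \<ge> 2 \<longrightarrow> 0 < u \<longrightarrow> u < 1 \<longrightarrow>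
      roundoffs n u \<eta> \<sigma> \<delta> \<beta> \<longrightarrow>
      compensated_summation n x \<eta> \<sigma> \<delta> \<beta> yh sh ch \<longrightarrow>
      (\<forall>k\<in>{2..n}.
         (vector [sh k - partial_sum x k, ch k] :: real^2) =
           (\<Sum>j=2..k - 1. (desc_prod (P_mat \<eta> \<sigma> \<delta> \<beta>) j k ** P_tilde \<eta> \<sigma> \<delta> \<beta> j)
                            *v vector [partial_sum x j, x j])
           + P_tilde \<eta> \<sigma> \<delta> \<beta> k *v vector [partial_sum x k, x k]))
   \<and>
   (\<exists>C>0. \<forall>\<^sub>F u in at_right (0::real).
      \<forall>(n::nat) \<eta> \<sigma> \<delta> \<beta>. n \<ge> 2 \<longrightarrow> roundoffs n u \<eta> \<sigma> \<delta> \<beta> \<longrightarrow>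
        (\<forall>j\<in>{2..n}. \<forall>a b. \<bar>P_tilde \<eta> \<sigma> \<delta> \<beta> j $ a $ b\<bar> \<le> C * u))"
proof (intro conjI allI impI ballI)
  fix n :: nat and u :: real and x \<eta> \<sigma> \<delta> \<beta> yh sh ch :: "nat \<Rightarrow> real" and k :: nat
  assume cs: "compensated_summation n x \<eta> \<sigma> \<delta> \<beta> yh sh ch" and k: "k \<in> {2..n}"
  let ?v = "\<lambda>m. vector [sh m - partial_sum x m, ch m] :: real^2"
  let ?P = "P_mat \<eta> \<sigma> \<delta> \<beta>"
  let ?w = "\<lambda>j. P_tilde \<eta> \<sigma> \<delta> \<beta> j *v vector [partial_sum x j, x j]"
  have "?v 1 = 0"
    using cs by (simp add: compensated_summation_def partial_sum_def vec_eq_iff forall_2)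
  then have "?v k = (\<Sum>j=2..k. desc_prod ?P j k *v ?w j)"
    using error_recurrence[OF cs] k by (intro affine_recurrence_unroll[where n = n]) auto
  also have "{2..k} = insert k {2..k - 1}"
    using k by auto
  also have "(\<Sum>j\<in>insert k {2..k - 1}. desc_prod ?P j k *v ?w j)
      = (\<Sum>j=2..k - 1. desc_prod ?P j k *v ?w j) + ?w k"
    using k by (subst sum.insert) (auto simp: desc_prod_refl)
  finally show "?v k = (\<Sum>j=2..k - 1. (desc_prod ?P j k ** P_tilde \<eta> \<sigma> \<delta> \<beta> j)
                            *v vector [partial_sum x j, x j]) + ?w k"
    by (simp add: matrix_vector_mul_assoc)
next
  have "\<forall>\<^sub>F u in at_right (0::real). u \<le> 1"
    by (rule eventually_at_rightI[of 0 1]) auto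
  then have "\<forall>\<^sub>F u in at_right (0::real).
      \<forall>(n::nat) \<eta> \<sigma> \<delta> \<beta>. n \<ge> 2 \<longrightarrow> roundoffs n u \<eta> \<sigma> \<delta> \<beta> \<longrightarrow>
        (\<forall>j\<in>{2..n}. \<forall>a b. \<bar>P_tilde \<eta> \<sigma> \<delta> \<beta> j $ a $ b\<bar> \<le> 8 * u)"
    by eventually_elim (blast intro: P_tilde_entry_bound)
  then show "\<exists>C>0. \<forall>\<^sub>F u in at_right (0::real).
      \<forall>(n::nat) \<eta> \<sigma> \<delta> \<beta>. n \<ge> 2 \<longrightarrow> roundoffs n u \<eta> \<sigma> \<delta> \<beta> \<longrightarrow>
        (\<forall>j\<in>{2..n}. \<forall>a b. \<bar>P_tilde \<eta> \<sigma> \<delta> \<beta> j $ a $ b\<bar> \<le> C * u)"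
    by (intro exI[of _ 8]) simp
qed

end
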